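(* Let $\alpha : I \subset \mathbb{R} \to \mathbb{E}^4$ be a unit speed curve with nonzero curvatures $k_i$ ($i=1,2,3$) according to the parallel transport frame $\{T, M_1, M_2, M_3\}$ in Euclidean $4$-space $\mathbb{E}^4$. Then $\alpha$ lies on a sphere if and only if there are non-zero constants $a$, $b$, $c$ such that $a k_1 + b k_2 + c k_3 + 1 = 0$ along $\alpha$.
   Context: $\mathbb{E}^4$ is $\mathbb{R}^4$ with the standard inner product $\langle\cdot,\cdot\rangle$; primes denote derivatives with respect to the arclength parameter $s$, and curves are sufficiently differentiable. A vector field along a unit speed curve $\alpha$ that is perpendicular to $T=\alpha'$ is called relatively parallel if its derivative is tangential (a multiple of $T$) along $\alpha$. A parallel transport frame of $\alpha$ is an orthonormal frame $\{T, M_1, M_2, M_3\}$ along $\alpha$ with $T=\alpha'$ and $M_1, M_2, M_3$ relatively parallel; its curvatures are $k_i = \langle T', M_i\rangle$, so that $T' = k_1M_1+k_2M_2+k_3M_3$ and $M_i' = -k_iT$ for $i=1,2,3$. A curve lies on a sphere if $\langle \alpha - P, \alpha - P\rangle = r^2$ for some fixed point $P\in\mathbb{E}^4$ and some constant $r>0$.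
   Formalization: "Non-zero constants a, b, c" is taken as "not all zero" instead of each non-zero, since a spherical curve with k1=1+s², k2=-1-s, k3=s on (0,1) admits only (a,b,c)=(0,1,1). *)

theory Defs
  imports "HOL-Analysis.Analysis"
begin

text \<open>
  A curve is a total function of which only the values on the interval \<open>I\<close> matter. All derivatives
  are taken within \<open>I\<close>, hence are one-sided at endpoints belonging to \<open>I\<close>; they are meaningful
  because \<open>I\<close> is always assumed to be an interval with nonempty interior.
\<close>

definition tangent :: "real set \<Rightarrow> (real \<Rightarrow> real ^ 4) \<Rightarrow> real \<Rightarrow> real ^ 4" where
  "tangent I \<alpha> s = vector_derivative \<alpha> (at s within I)"

text \<open>
  ``Sufficiently differentiable'' is rendered as twice differentiable, the least regularity for
  which the second derivative in the definition of the curvatures below makes sense.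
\<close>

definition unit_speed_curve :: "real set \<Rightarrow> (real \<Rightarrow> real ^ 4) \<Rightarrow> bool" where
  "unit_speed_curve I \<alpha> \<longleftrightarrow>
     \<alpha> differentiable_on I \<and> tangent I \<alpha> differentiable_on I \<and>
     (\<forall>s\<in>I. norm (tangent I \<alpha> s) = 1)"

definition relatively_parallel ::
  "real set \<Rightarrow> (real \<Rightarrow> real ^ 4) \<Rightarrow> (real \<Rightarrow> real ^ 4) \<Rightarrow> bool" where
  "relatively_parallel I \<alpha> M \<longleftrightarrow>
     M differentiable_on I \<and>
     (\<forall>s\<in>I. M s \<bullet> tangent I \<alpha> s = 0) \<and>
     (\<forall>s\<in>I. \<exists>c. vector_derivative M (at s within I) = c *\<^sub>R tangent I \<alpha> s)"

definition orthonormal_frame ::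
  "real set \<Rightarrow> (real \<Rightarrow> real ^ 4) \<Rightarrow> (real \<Rightarrow> real ^ 4) \<Rightarrow> (real \<Rightarrow> real ^ 4) \<Rightarrow>
     (real \<Rightarrow> real ^ 4) \<Rightarrow> bool" where
  "orthonormal_frame I X0 X1 X2 X3 \<longleftrightarrow>
     (\<forall>s\<in>I. norm (X0 s) = 1 \<and> norm (X1 s) = 1 \<and> norm (X2 s) = 1 \<and> norm (X3 s) = 1 \<and>
        X0 s \<bullet> X1 s = 0 \<and> X0 s \<bullet> X2 s = 0 \<and> X0 s \<bullet> X3 s = 0 \<and>
        X1 s \<bullet> X2 s = 0 \<and> X1 s \<bullet> X3 s = 0 \<and> X2 s \<bullet> X3 s = 0)"

definition parallel_transport_frame ::
  "real set \<Rightarrow> (real \<Rightarrow> real ^ 4) \<Rightarrow> (real \<Rightarrow> real ^ 4) \<Rightarrow> (real \<Rightarrow> real ^ 4) \<Rightarrow>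
     (real \<Rightarrow> real ^ 4) \<Rightarrow> bool" where
  "parallel_transport_frame I \<alpha> M1 M2 M3 \<longleftrightarrow>
     orthonormal_frame I (tangent I \<alpha>) M1 M2 M3 \<and>
     relatively_parallel I \<alpha> M1 \<and> relatively_parallel I \<alpha> M2 \<and> relatively_parallel I \<alpha> M3"

definition frame_curvature ::
  "real set \<Rightarrow> (real \<Rightarrow> real ^ 4) \<Rightarrow> (real \<Rightarrow> real ^ 4) \<Rightarrow> real \<Rightarrow> real" where
  "frame_curvature I \<alpha> M s = vector_derivative (tangent I \<alpha>) (at s within I) \<bullet> M s"

definition lies_on_sphere :: "real set \<Rightarrow> (real \<Rightarrow> real ^ 4) \<Rightarrow> bool" where
  "lies_on_sphere I \<alpha> \<longleftrightarrow> (\<exists>P r. r > 0 \<and> (\<forall>s\<in>I. (\<alpha> s - P) \<bullet> (\<alpha> s - P) = r\<^sup>2))"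

end

theory Submission
  imports Defs
begin

text \<open>
  The function \<open>(\<alpha> - P) \<bullet> M\<close> is constant as soon as \<open>M\<close> is relatively parallel and \<open>\<alpha> - P\<close> is
  normal to \<open>T\<close>. On a sphere with centre \<open>P\<close> this makes the components \<open>a\<close>, \<open>b\<close>, \<open>c\<close> of \<open>\<alpha> - P\<close>
  along the frame constant, and differentiating \<open>(\<alpha> - P) \<bullet> T = 0\<close> gives the linear relation.
  Conversely, the linear relation says exactly that \<open>\<alpha> - a M\<^sub>1 - b M\<^sub>2 - c M\<^sub>3\<close> has
  derivative zero; its constant value is the centre.
\<close>

text \<open>What remains of \<open>v\<close> after subtracting its projections is orthogonal to all
  four frame vectors. Were it nonzero, five pairwise orthogonal nonzero vectors would be independent
  in a space of dimension 4.\<close>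

lemma orthonormal_expansion_4:
  fixes e0 e1 e2 e3 v :: "real ^ 4"
  assumes n: "norm e0 = 1" "norm e1 = 1" "norm e2 = 1" "norm e3 = 1"
    and o: "e0 \<bullet> e1 = 0" "e0 \<bullet> e2 = 0" "e0 \<bullet> e3 = 0" "e1 \<bullet> e2 = 0" "e1 \<bullet> e3 = 0" "e2 \<bullet> e3 = 0"
  shows "v = (v \<bullet> e0) *\<^sub>R e0 + (v \<bullet> e1) *\<^sub>R e1 + (v \<bullet> e2) *\<^sub>R e2 + (v \<bullet> e3) *\<^sub>R e3"
proof (rule ccontr)
  define w where "w = v - ((v \<bullet> e0) *\<^sub>R e0 + (v \<bullet> e1) *\<^sub>R e1 + (v \<bullet> e2) *\<^sub>R e2 + (v \<bullet> e3) *\<^sub>R e3)"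
  assume "\<not> ?thesis"
  then have "w \<noteq> 0" unfolding w_def by simp
  have one: "e0 \<bullet> e0 = 1" "e1 \<bullet> e1 = 1" "e2 \<bullet> e2 = 1" "e3 \<bullet> e3 = 1"
    using n by (simp_all add: norm_eq_1)
  have "w \<bullet> e0 = 0" "w \<bullet> e1 = 0" "w \<bullet> e2 = 0" "w \<bullet> e3 = 0"
    unfolding w_def using one o by (simp_all add: inner_diff_right inner_add_right inner_commute)
  note ow = this
  let ?S = "{w, e0, e1, e2, e3}"
  have nz: "e0 \<noteq> 0" "e1 \<noteq> 0" "e2 \<noteq> 0" "e3 \<noteq> 0" using n by auto
  have "pairwise orthogonal ?S"
    using o ow by (auto simp: pairwise_def orthogonal_def inner_commute)
  moreover have "0 \<notin> ?S" using nz \<open>w \<noteq> 0\<close> by auto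
  ultimately have "independent ?S" by (rule pairwise_orthogonal_independent)
  then have "card ?S \<le> 4" using independent_bound[of ?S] by simp
  \<comment> \<open>The set has five elements: a coincidence would make some unit vector
    \<open>ei\<close> orthogonal to itself.\<close>
  moreover have "distinct [w, e0, e1, e2, e3]"
    using one o ow by auto
  then have "card ?S = 5" using distinct_card[of "[w, e0, e1, e2, e3]"] by simp
  ultimately show False by simp
qed

text \<open>This makes derivatives within \<open>I\<close> unique, also at endpoints. A connected
  set with more than one point has no isolated points.\<close>

lemma at_within_interval_neq_bot:
  fixes I :: "real set"
  assumes "is_interval I" "interior I \<noteq> {}" "s \<in> I"
  shows "at s within I \<noteq> bot"
proof -
  have "I \<noteq> {s}" using assms(2) by auto
  then have "s islimpt I"
    using assms(1,3) is_interval_connected connected_imp_perfect by blast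
  then show ?thesis by (simp add: trivial_limit_within)
qed

lemma has_vector_derivative_zero_on_interval_constant:
  fixes f :: "real \<Rightarrow> 'a :: real_normed_vector"
  assumes "is_interval I" "\<And>s. s \<in> I \<Longrightarrow> (f has_vector_derivative 0) (at s within I)"
  obtains c where "\<And>s. s \<in> I \<Longrightarrow> f s = c"
  using has_derivative_zero_constant[OF is_interval_convex[OF assms(1)], of f] assms(2) that
  by (auto simp: has_vector_derivative_def)

text \<open>Serves to differentiate identities that hold only on \<open>I\<close>: \<open>D\<close>
  is whatever the product rule yields, and uniqueness of the derivative forces it to vanish.\<close>

lemma constant_on_has_vector_derivative_zero:
  fixes f :: "real \<Rightarrow> 'a :: real_normed_vector"
  assumes "\<And>t. t \<in> I \<Longrightarrow> f t = c" "s \<in> I" "at s within I \<noteq> bot"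
    "(f has_vector_derivative D) (at s within I)"
  shows "D = 0"
proof -
  have "((\<lambda>_. c) has_vector_derivative D) (at s within I)"
    using has_vector_derivative_transform[OF assms(2) _ assms(4), of "\<lambda>_. c"] assms(1) by simp
  then show ?thesis
    using vector_derivative_unique_within[OF assms(3) _ has_vector_derivative_const] by blast
qed

lemma unit_speed_curve_derivatives:
  assumes "unit_speed_curve I \<alpha>" "s \<in> I"
  shows "(\<alpha> has_vector_derivative tangent I \<alpha> s) (at s within I)"
    and "(tangent I \<alpha> has_vector_derivative vector_derivative (tangent I \<alpha>) (at s within I))
           (at s within I)"
  using assms unfolding unit_speed_curve_def differentiable_on_def tangent_def
  by (auto simp: vector_derivative_works[symmetric])

text \<open>The definition only provides some factor \<open>c\<close> with M' = c T. Differentiating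
  M \<bullet> T = 0 gives M \<bullet> T' + c = 0 because T is a unit vector, and this identifies
  \<open>c\<close>.\<close>

lemma relatively_parallel_derivative:
  assumes "is_interval I" "interior I \<noteq> {}" "unit_speed_curve I \<alpha>"
    and M: "relatively_parallel I \<alpha> M" and s: "s \<in> I"
  shows "(M has_vector_derivative - frame_curvature I \<alpha> M s *\<^sub>R tangent I \<alpha> s) (at s within I)"
proof -
  let ?T = "tangent I \<alpha>" and ?F = "at s within I"
  let ?T' = "vector_derivative ?T ?F"
  obtain c where c: "vector_derivative M ?F = c *\<^sub>R ?T s"
    using M s unfolding relatively_parallel_def by blast
  have "M differentiable ?F"
    using M s by (simp add: relatively_parallel_def differentiable_on_def)
  then have dM: "(M has_vector_derivative c *\<^sub>R ?T s) ?F"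
    using c by (simp add: vector_derivative_works)
  have "((\<lambda>t. M t \<bullet> ?T t) has_vector_derivative M s \<bullet> ?T' + (c *\<^sub>R ?T s) \<bullet> ?T s) ?F"
    by (rule bounded_bilinear.has_vector_derivative[OF bounded_bilinear_inner dM
          unit_speed_curve_derivatives(2)[OF assms(3) s]])
  then have "M s \<bullet> ?T' + (c *\<^sub>R ?T s) \<bullet> ?T s = 0"
    using M s by (intro constant_on_has_vector_derivative_zero[OF _ s
          at_within_interval_neq_bot[OF assms(1,2) s]])
      (auto simp: relatively_parallel_def)
  moreover have "?T s \<bullet> ?T s = 1"
    using assms(3) s by (simp add: unit_speed_curve_def norm_eq_1)
  ultimately have "c = - frame_curvature I \<alpha> M s"
    by (simp add: frame_curvature_def inner_commute)
  then show ?thesis using dM by simp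
qed

text \<open>The product rule gives T \<bullet> M - k (\<alpha> - P) \<bullet> T, where k is the
  curvature belonging to M; both terms vanish by orthogonality to T.\<close>

lemma relatively_parallel_component_constant:
  assumes "is_interval I" "interior I \<noteq> {}" "unit_speed_curve I \<alpha>"
    and M: "relatively_parallel I \<alpha> M"
    and normal: "\<And>s. s \<in> I \<Longrightarrow> (\<alpha> s - P) \<bullet> tangent I \<alpha> s = 0"
  obtains c where "\<And>s. s \<in> I \<Longrightarrow> (\<alpha> s - P) \<bullet> M s = c"
proof (rule has_vector_derivative_zero_on_interval_constant[OF assms(1)])
  fix s assume s: "s \<in> I"
  have "((\<lambda>s. \<alpha> s - P) has_vector_derivative tangent I \<alpha> s) (at s within I)"
    using has_vector_derivative_diff[OF unit_speed_curve_derivatives(1)[OF assms(3) s]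
        has_vector_derivative_const[of P]] by simp
  from bounded_bilinear.has_vector_derivative[OF bounded_bilinear_inner this
      relatively_parallel_derivative[OF assms(1-4) s]]
  show "((\<lambda>s. (\<alpha> s - P) \<bullet> M s) has_vector_derivative 0) (at s within I)"
    using normal[OF s] M s by (simp add: relatively_parallel_def inner_commute)
qed (use that in blast)

theorem theorem2:
  fixes I :: "real set"
    and \<alpha> M1 M2 M3 :: "real \<Rightarrow> real ^ 4"
    and k1 k2 k3 :: "real \<Rightarrow> real"
  assumes "is_interval I" and "interior I \<noteq> {}"
    and "unit_speed_curve I \<alpha>"
    and "parallel_transport_frame I \<alpha> M1 M2 M3"
    and "\<And>s. s \<in> I \<Longrightarrow> k1 s = frame_curvature I \<alpha> M1 s"
    and "\<And>s. s \<in> I \<Longrightarrow> k2 s = frame_curvature I \<alpha> M2 s"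
    and "\<And>s. s \<in> I \<Longrightarrow> k3 s = frame_curvature I \<alpha> M3 s"
    and "\<And>s. s \<in> I \<Longrightarrow> k1 s \<noteq> 0 \<and> k2 s \<noteq> 0 \<and> k3 s \<noteq> 0"
  shows "lies_on_sphere I \<alpha> \<longleftrightarrow>
    (\<exists>a b c :: real. (a, b, c) \<noteq> (0, 0, 0) \<and>
       (\<forall>s\<in>I. a * k1 s + b * k2 s + c * k3 s + 1 = 0))"
proof
  let ?T = "tangent I \<alpha>"
  let ?T' = "\<lambda>s. vector_derivative ?T (at s within I)"
  have par: "relatively_parallel I \<alpha> M1" "relatively_parallel I \<alpha> M2" "relatively_parallel I \<alpha> M3"
    and frame: "orthonormal_frame I ?T M1 M2 M3"
    using assms(4) by (auto simp: parallel_transport_frame_def)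
  note nontrivial = at_within_interval_neq_bot[OF assms(1,2)]
  note d\<alpha> = unit_speed_curve_derivatives(1)[OF assms(3)]
  note dT = unit_speed_curve_derivatives(2)[OF assms(3)]
  {
    assume "lies_on_sphere I \<alpha>"
    then obtain P r where sphere: "\<And>s. s \<in> I \<Longrightarrow> (\<alpha> s - P) \<bullet> (\<alpha> s - P) = r\<^sup>2"
      unfolding lies_on_sphere_def by blast
    have d: "((\<lambda>s. \<alpha> s - P) has_vector_derivative ?T s) (at s within I)" if "s \<in> I" for s
      using has_vector_derivative_diff[OF d\<alpha>[OF that] has_vector_derivative_const[of P]] by simp
    \<comment> \<open>The derivative of the constant squared distance is twice this inner
      product.\<close>
    have normal: "(\<alpha> s - P) \<bullet> ?T s = 0" if s: "s \<in> I" for s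
      using constant_on_has_vector_derivative_zero[OF sphere s nontrivial[OF s]
          bounded_bilinear.has_vector_derivative[OF bounded_bilinear_inner d[OF s] d[OF s]]]
      by (simp add: inner_commute)
    \<comment> \<open>Differentiating \<open>normal\<close> once more; the summand 1 is T \<bullet>
      T.\<close>
    have second: "(\<alpha> s - P) \<bullet> ?T' s + 1 = 0" if s: "s \<in> I" for s
      using constant_on_has_vector_derivative_zero[OF normal s nontrivial[OF s]
          bounded_bilinear.has_vector_derivative[OF bounded_bilinear_inner d[OF s] dT[OF s]]]
        frame s by (simp add: orthonormal_frame_def norm_eq_1)
    obtain a where a: "\<And>s. s \<in> I \<Longrightarrow> (\<alpha> s - P) \<bullet> M1 s = a"
      using relatively_parallel_component_constant[OF assms(1-3) par(1) normal] by blast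
    obtain b where b: "\<And>s. s \<in> I \<Longrightarrow> (\<alpha> s - P) \<bullet> M2 s = b"
      using relatively_parallel_component_constant[OF assms(1-3) par(2) normal] by blast
    obtain c where c: "\<And>s. s \<in> I \<Longrightarrow> (\<alpha> s - P) \<bullet> M3 s = c"
      using relatively_parallel_component_constant[OF assms(1-3) par(3) normal] by blast
    have rel: "a * k1 s + b * k2 s + c * k3 s + 1 = 0" if s: "s \<in> I" for s
    proof -
      \<comment> \<open>The T-component drops out by \<open>normal\<close>, and the other
        coefficients are the constants found above. Pairing with T' then turns each normal vector
        into its curvature.\<close>
      have "\<alpha> s - P = ((\<alpha> s - P) \<bullet> ?T s) *\<^sub>R ?T s + ((\<alpha> s - P) \<bullet> M1 s) *\<^sub>R M1 s
          + ((\<alpha> s - P) \<bullet> M2 s) *\<^sub>R M2 s + ((\<alpha> s - P) \<bullet> M3 s) *\<^sub>R M3 s"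
        using frame s unfolding orthonormal_frame_def by (intro orthonormal_expansion_4) auto
      then have "\<alpha> s - P = a *\<^sub>R M1 s + b *\<^sub>R M2 s + c *\<^sub>R M3 s"
        by (simp only: normal[OF s] a[OF s] b[OF s] c[OF s] scaleR_zero_left add_0)
      then have "(\<alpha> s - P) \<bullet> ?T' s = a * k1 s + b * k2 s + c * k3 s"
        by (simp add: assms(5-7)[OF s] frame_curvature_def inner_add_right inner_commute)
      then show ?thesis using second[OF s] by simp
    qed
    \<comment> \<open>At any point of \<open>I\<close>, a zero triple would turn the relation into 1
      = 0.\<close>
    obtain s where "s \<in> I" using assms(2) interior_subset by blast
    with rel[of s] have "(a, b, c) \<noteq> (0, 0, 0)" by auto
    with rel show "\<exists>a b c :: real. (a, b, c) \<noteq> (0, 0, 0) \<and>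
       (\<forall>s\<in>I. a * k1 s + b * k2 s + c * k3 s + 1 = 0)" by blast
  next
    assume "\<exists>a b c :: real. (a, b, c) \<noteq> (0, 0, 0) \<and>
       (\<forall>s\<in>I. a * k1 s + b * k2 s + c * k3 s + 1 = 0)"
    then obtain a b c where nz: "(a, b, c) \<noteq> (0, 0, 0 :: real)"
      and rel: "\<And>s. s \<in> I \<Longrightarrow> a * k1 s + b * k2 s + c * k3 s + 1 = 0" by blast
    have "((\<lambda>s. \<alpha> s - (a *\<^sub>R M1 s + b *\<^sub>R M2 s + c *\<^sub>R M3 s)) has_vector_derivative 0) (at s within I)"
      if s: "s \<in> I" for s
    proof -
      note dM = relatively_parallel_derivative[OF assms(1-3) _ s]
      \<comment> \<open>Since each normal vector has derivative -k T, the whole derivative is a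
        multiple of T, whose factor is the left side of the assumed relation.\<close>
      have "((\<lambda>s. \<alpha> s - (a *\<^sub>R M1 s + b *\<^sub>R M2 s + c *\<^sub>R M3 s)) has_vector_derivative
          ?T s - (a *\<^sub>R (- k1 s *\<^sub>R ?T s) + b *\<^sub>R (- k2 s *\<^sub>R ?T s) + c *\<^sub>R (- k3 s *\<^sub>R ?T s)))
          (at s within I)"
        unfolding assms(5-7)[OF s]
        by (intro has_vector_derivative_diff has_vector_derivative_add d\<alpha>[OF s]
            bounded_linear.has_vector_derivative[OF bounded_linear_scaleR_right] dM par)
      moreover have "?T s - (a *\<^sub>R (- k1 s *\<^sub>R ?T s) + b *\<^sub>R (- k2 s *\<^sub>R ?T s) + c *\<^sub>R (- k3 s *\<^sub>R ?T s))
          = (a * k1 s + b * k2 s + c * k3 s + 1) *\<^sub>R ?T s"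
        by (simp add: algebra_simps)
      ultimately show ?thesis using rel[OF s] by simp
    qed
    then obtain P where P: "\<And>s. s \<in> I \<Longrightarrow> \<alpha> s - (a *\<^sub>R M1 s + b *\<^sub>R M2 s + c *\<^sub>R M3 s) = P"
      using has_vector_derivative_zero_on_interval_constant[OF assms(1)] by blast
    \<comment> \<open>The radius comes from Pythagoras, the normal vectors being orthonormal; it is
      positive because the triple is not zero.\<close>
    have "(\<alpha> s - P) \<bullet> (\<alpha> s - P) = (sqrt (a\<^sup>2 + b\<^sup>2 + c\<^sup>2))\<^sup>2" if s: "s \<in> I" for s
    proof -
      have "\<alpha> s - P = a *\<^sub>R M1 s + b *\<^sub>R M2 s + c *\<^sub>R M3 s"
        using P[OF s] by (simp add: algebra_simps)
      then show ?thesis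
        using frame s
        by (simp add: orthonormal_frame_def norm_eq_1 inner_add_left inner_add_right
            inner_commute power2_eq_square)
    qed
    moreover have "sqrt (a\<^sup>2 + b\<^sup>2 + c\<^sup>2) > 0"
      using nz by (auto simp: add_pos_nonneg add_nonneg_pos)
    ultimately show "lies_on_sphere I \<alpha>" unfolding lies_on_sphere_def by blast
  }
qed

end
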